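(* Let $k\ge1$ be an integer. For every integer $n\ge0$, $$\mathcal{P}_k(n)=\frac{1}{D[k]\,(3k)!}\sum_{J\subseteq\{\alpha_k+1,\ldots,k\}}\ \sum_{(t_1,\ldots,t_{\beta_k})\in\mathbf{B}_k} s_k(t_1,\ldots,t_{\beta_k})\prod_{\ell=1}^{3k}\left(\frac{n-\sum_{j=1}^{\beta_k}t_j\varphi_k(j)-m_J}{D[k]}+\ell\right),$$ where $m_J=\sum_{i\in J}(3i-1)$ and $\mathbf{B}_k$ is the set of integer tuples $(t_1,\ldots,t_{\beta_k})$ such that $0\le t_j\le\varepsilon_k(j)\left(\frac{D[k]}{\varphi_k(j)}-1\right)$ for all $1\le j\le\beta_k$.
   Context: A plane partition diamond of length $k$ of $n$ is a sequence $(a_1,\ldots,a_{3k+1})$ of nonnegative integers with sum $n$ such that, for all $0\le i\le k-1$, $a_{3i+1}\ge a_{3i+2}$, $a_{3i+1}\ge a_{3i+3}$, $a_{3i+2}\ge a_{3i+4}$, $a_{3i+3}\ge a_{3i+4}$; $\mathcal{D}_k(n)$ denotes the number of these, and $\mathcal{P}_k(n)$ is its polynomial part, defined as follows. For a sequence $\mathbf a=(a_1,\ldots,a_r)$ of positive integers, let $p_{\mathbf a}(n)$ be the number of nonnegative integer solutions of $a_1x_1+\cdots+a_rx_r=n$. The polynomial part $P_{\mathbf a}(n)$ of $p_{\mathbf a}(n)$ (the first Sylvester wave $W_1(n,\mathbf a)$) is the coefficient of $t^{-1}$ in the Laurent expansion at $t=0$ of $$\frac{e^{nt}}{(1-e^{-a_1t})\cdots(1-e^{-a_rt})};$$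 it is a polynomial in $n$ (and is evaluated as such at any integer). For $k\ge1$, $\mathbf a[k]=(a[k]_1,\ldots,a[k]_{3k+1})$ is the sequence with $a[k]_j=j$ if $j\not\equiv4\pmod6$ and $a[k]_j=j/2$ if $j\equiv4\pmod6$. With $\alpha_k=\lfloor\frac{k+1}{2}\rfloor$, the polynomial part of $\mathcal{D}_k(n)$ is $$\mathcal{P}_k(n):=\sum_{J\subseteq\{\alpha_k+1,\ldots,k\}}P_{\mathbf a[k]}(n-m_J),\qquad m_J=\sum_{i\in J}(3i-1),$$ where $J=\emptyset$ is allowed, with $m_\emptyset=0$. Further notation: $\beta_k=5\alpha_k-2$ if $k$ is odd and $\beta_k=5\alpha_k+1$ if $k$ is even; $\mathcal{B}_k=\{1,2,\ldots,\beta_k\}$; $\mathcal{A}_k=\{1\le j\le 3k+1 : j\not\equiv4\pmod6\}$; $D[k]=\operatorname{lcm}(\mathcal{A}_k)$. The map $\varphi_k:\mathcal{B}_k\to\mathcal{A}_k$, $\varphi_k(j)=j+\left\lceil\frac{j-3}{5}\right\rceil$, is a bijection with inverse $\varphi_k^{-1}(j)=j-\left\lceil\frac{j-3}{6}\right\rceil$. $\mathcal{B}'_k=\{j\in\mathcal{B}_k : j\equiv 2 \text{ or } 4\pmod5 \text{ and } j\le\varphi_k^{-1}(3\alpha_k-1)\}$. The function $\varepsilon_k:\mathcal{B}_k\to\{1,2\}$ is $\varepsilon_k(j)=2$ if $j\in\mathcal{B}'_k$ and $\varepsilon_k(j)=1$ otherwise. $$s_k(t_1,\ldots,t_{\beta_k})=\prod_{j\in\mathcal{B}'_k}\left(1+\min\left\{t_j,\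 2\left(\frac{D[k]}{\varphi_k(j)}-1\right)-t_j\right\}\right).$$ *)

theory Defs
  imports Complex_Main "HOL-Computational_Algebra.Formal_Laurent_Series" "HOL-Library.FuncSet"
begin

(* The Laurent expansion of e^(c t) at t = 0. *)
abbreviation fls_exp :: "real \<Rightarrow> real fls" where
  "fls_exp c \<equiv> fps_to_fls (fps_exp c)"

(* First Sylvester wave of p_a: the coefficient of t^(-1) in
   e^(n t) / ((1 - e^(-a_1 t)) ... (1 - e^(-a_r t))).  The quotient is taken in the field of
   formal Laurent series; a is meant to consist of positive integers, so that no factor is 0. *)
definition poly_part :: "nat list \<Rightarrow> int \<Rightarrow> real" where
  "poly_part a n =
     fls_residue (fls_exp (of_int n) / (\<Prod>x\<leftarrow>a. 1 - fls_exp (- real x)))"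

definition a_seq :: "nat \<Rightarrow> nat list" where
  "a_seq k = map (\<lambda>j. if j mod 6 = 4 then j div 2 else j) [1..<3 * k + 2]"

definition alpha :: "nat \<Rightarrow> nat" where
  "alpha k = (k + 1) div 2"

definition beta :: "nat \<Rightarrow> int" where
  "beta k = (if odd k then 5 * int (alpha k) - 2 else 5 * int (alpha k) + 1)"

definition mJ :: "nat set \<Rightarrow> int" where
  "mJ J = (\<Sum>i\<in>J. 3 * int i - 1)"

(* Polynomial part of the number of plane partition diamonds of length k. *)
definition PP :: "nat \<Rightarrow> int \<Rightarrow> real" where
  "PP k n = (\<Sum>J\<in>Pow {alpha k + 1..k}. poly_part (a_seq k) (n - mJ J))"

definition Bset :: "nat \<Rightarrow> int set" where
  "Bset k = {1..beta k}"

definition Aset :: "nat \<Rightarrow> int set" where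
  "Aset k = {j. 1 \<le> j \<and> j \<le> 3 * int k + 1 \<and> j mod 6 \<noteq> 4}"

definition DD :: "nat \<Rightarrow> int" where
  "DD k = Lcm (Aset k)"

(* The formulas for phi_k and its inverse do not involve k; only the domains Bset k and Aset k do
   (see phi_bij and phi_inv_correct below). *)
definition phi :: "int \<Rightarrow> int" where
  "phi j = j + \<lceil>real_of_int (j - 3) / 5\<rceil>"

definition phi_inv :: "int \<Rightarrow> int" where
  "phi_inv j = j - \<lceil>real_of_int (j - 3) / 6\<rceil>"

definition Bset' :: "nat \<Rightarrow> int set" where
  "Bset' k = {j \<in> Bset k. (j mod 5 = 2 \<or> j mod 5 = 4) \<and> j \<le> phi_inv (3 * int (alpha k) - 1)}"

definition eps :: "nat \<Rightarrow> int \<Rightarrow> int" where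
  "eps k j = (if j \<in> Bset' k then 2 else 1)"

(* The division is exact for j in Bset k, by phi_dvd below. *)
definition s_weight :: "nat \<Rightarrow> (int \<Rightarrow> int) \<Rightarrow> int" where
  "s_weight k t = (\<Prod>j\<in>Bset' k. 1 + min (t j) (2 * (DD k div phi j - 1) - t j))"

(* Tuples are functions on Bset k; PiE makes them undefined elsewhere, so that each tuple is
   counted once. *)
definition Box :: "nat \<Rightarrow> (int \<Rightarrow> int) set" where
  "Box k = (\<Pi>\<^sub>E j\<in>Bset k. {0..eps k j * (DD k div phi j - 1)})"

lemma phi_alt: "phi j = j + (j + 1) div 5"
proof -
  have "phi j = j - (- (j - 3)) div 5"
    using ceiling_divide_eq_div[of "j - 3" 5, where 'a = real] by (simp add: phi_def)
  also have "\<dots> = j + (j + 1) div 5" by presburger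
  finally show ?thesis .
qed

lemma phi_inv_alt: "phi_inv j = j - (j + 2) div 6"
proof -
  have "phi_inv j = j + (- (j - 3)) div 6"
    using ceiling_divide_eq_div[of "j - 3" 6, where 'a = real] by (simp add: phi_inv_def)
  also have "\<dots> = j - (j + 2) div 6" by presburger
  finally show ?thesis .
qed

lemma alpha_bounds: "2 * int (alpha k) \<le> int k + 1" "int k \<le> 2 * int (alpha k)"
  unfolding alpha_def by linarith+

lemma beta_alt: "beta k = 3 * int k + 1 - int (alpha k)"
proof (cases "odd k")
  case True
  then obtain m where "k = 2 * m + 1" by (rule oddE)
  then show ?thesis by (simp add: beta_def alpha_def)
next
  case False
  then have "even k" by simp
  then obtain m where "k = 2 * m" by (rule evenE)
  then show ?thesis by (simp add: beta_def alpha_def)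
qed

lemma phi_cases:
  obtains q r where "j = 5 * q + r - 1" "0 \<le> r" "r < 5" "phi j = 6 * q + r - 1"
proof
  show "j = 5 * ((j + 1) div 5) + (j + 1) mod 5 - 1"
    and "phi j = 6 * ((j + 1) div 5) + (j + 1) mod 5 - 1"
    unfolding phi_alt using mult_div_mod_eq[of 5 "j + 1"] by linarith+
qed simp_all

lemma phi_inv_cases:
  assumes "j \<in> Aset k"
  obtains q r where "j = 6 * q + r - 2" "0 < r" "r < 6" "phi_inv j = 5 * q + r - 2"
proof
  have "j mod 6 \<noteq> 4" using assms by (simp add: Aset_def)
  then have "(j + 2) mod 6 \<noteq> 0" by presburger
  then show "0 < (j + 2) mod 6" by (simp add: order_less_le)
  show "j = 6 * ((j + 2) div 6) + (j + 2) mod 6 - 2"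
    and "phi_inv j = 5 * ((j + 2) div 6) + (j + 2) mod 6 - 2"
    unfolding phi_inv_alt using mult_div_mod_eq[of 6 "j + 2"] by linarith+
qed simp_all

lemma phi_in_Aset:
  assumes "j \<in> Bset k"
  shows "phi j \<in> Aset k"
proof -
  obtain q r where j: "j = 5 * q + r - 1" and r: "0 \<le> r" "r < 5" and phi: "phi j = 6 * q + r - 1"
    by (rule phi_cases)
  have b: "1 \<le> 5 * q + r - 1" "5 * q + r - 1 \<le> 3 * int k + 1 - int (alpha k)"
    using assms j by (simp_all add: Bset_def beta_alt)
  have "phi j mod 6 \<noteq> 4" using phi r by presburger
  moreover have "1 \<le> phi j" using phi b(1) r by linarith
  moreover have "phi j \<le> 3 * int k + 1"
    using phi b(2) alpha_bounds[of k] r by linarith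
  ultimately show ?thesis by (simp add: Aset_def)
qed

lemma phi_inv_in_Bset:
  assumes "j \<in> Aset k"
  shows "phi_inv j \<in> Bset k"
proof -
  obtain q r where j: "j = 6 * q + r - 2" and r: "0 < r" "r < 6" and inv: "phi_inv j = 5 * q + r - 2"
    using assms by (rule phi_inv_cases)
  have b: "1 \<le> 6 * q + r - 2" "6 * q + r - 2 \<le> 3 * int k + 1"
    using assms j by (simp_all add: Aset_def)
  consider "r = 1" | "r = 2" | "r = 3" | "r = 4" | "r = 5" using r by linarith
  then have "1 \<le> phi_inv j \<and> phi_inv j \<le> 3 * int k + 1 - int (alpha k)"
  proof cases
    case 1
    then have "1 \<le> q" "2 * q \<le> int k" using b by linarith+
    then show ?thesis using 1 inv alpha_bounds[of k] by linarith
  next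
    case 2
    then have "1 \<le> q" "2 * q \<le> int k" using b by linarith+
    then show ?thesis using 2 inv alpha_bounds[of k] by linarith
  next
    case 3
    then have "0 \<le> q" "2 * q \<le> int k" using b by linarith+
    then show ?thesis using 3 inv alpha_bounds[of k] by linarith
  next
    case 4
    then have "0 \<le> q" "2 * q + 1 \<le> int k" using b by linarith+
    then show ?thesis using 4 inv alpha_bounds[of k] by linarith
  next
    case 5
    then have "0 \<le> q" "2 * q + 1 \<le> int k" using b by linarith+
    then show ?thesis using 5 inv alpha_bounds[of k] by linarith
  qed
  then show ?thesis by (simp add: Bset_def beta_alt)
qed

lemma phi_inv_phi: "phi_inv (phi j) = j"
proof -
  obtain q r where j: "j = 5 * q + r - 1" and r: "0 \<le> r" "r < 5" and phi: "phi j = 6 * q + r - 1"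
    by (rule phi_cases)
  have "(phi j + 2) div 6 = q" using phi r by linarith
  then show ?thesis using j phi by (simp add: phi_inv_alt)
qed

lemma phi_phi_inv:
  assumes "j \<in> Aset k"
  shows "phi (phi_inv j) = j"
proof -
  obtain q r where j: "j = 6 * q + r - 2" and r: "0 < r" "r < 6" and inv: "phi_inv j = 5 * q + r - 2"
    using assms by (rule phi_inv_cases)
  have "(phi_inv j + 1) div 5 = q" using inv r by linarith
  then show ?thesis using j inv by (simp add: phi_alt)
qed

lemma phi_bij: "bij_betw phi (Bset k) (Aset k)"
  by (rule bij_betw_byWitness[where f' = phi_inv])
    (auto simp: phi_inv_phi phi_phi_inv phi_in_Aset phi_inv_in_Bset)

lemma phi_inv_correct: "j \<in> Aset k \<Longrightarrow> the_inv_into (Bset k) phi j = phi_inv j"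
  by (metis bij_betw_def phi_bij phi_inv_in_Bset phi_phi_inv the_inv_into_f_f)

lemma phi_dvd: "j \<in> Bset k \<Longrightarrow> phi j dvd DD k"
  by (simp add: DD_def phi_in_Aset)

lemma DD_pos: "DD k > 0"
proof -
  have "finite (Aset k)"
    by (rule finite_subset[of _ "{1..3 * int k + 1}"]) (auto simp: Aset_def)
  moreover have "0 \<notin> Aset k" by (simp add: Aset_def)
  ultimately have "DD k \<noteq> 0" by (simp add: DD_def Lcm_0_iff)
  moreover have "DD k \<ge> 0" by (simp add: DD_def)
  ultimately show ?thesis by simp
qed

end

theory Submission
  imports Defs
begin

text \<open>
  Up to order, the parts of \<open>a[k]\<close> are the numbers \<open>\<phi>\<^sub>k(j)\<close> with multiplicity
  \<open>\<epsilon>\<^sub>k(j)\<close>.  Expanding \<open>((1 - x\<^sup>m) / (1 - x)) ^ \<epsilon>\<close> with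
  \<open>x = e ^ (- \<phi>\<^sub>k(j) t)\<close> and \<open>m = D[k] / \<phi>\<^sub>k(j)\<close> puts all
  factors over the common denominator \<open>(1 - e ^ (- D[k] t)) ^ (3 k + 1)\<close>, at the price of the
  weights \<open>s\<^sub>k\<close>.  The residue of \<open>e ^ (c t) / (1 - e ^ (- D t)) ^ (r + 1)\<close> is then found
  by induction on \<open>r\<close>, since the residue of a derivative vanishes.
\<close>

section \<open>Residues of exponentials over powers of \<open>1 - e^(-d t)\<close>\<close>

lemma fls_exp_add: "fls_exp (a + b) = fls_exp a * fls_exp b"
  by (simp add: fps_exp_add_mult fls_times_fps_to_fls)

lemma fls_exp_power: "fls_exp a ^ n = fls_exp (real n * a)"
  by (simp add: fps_exp_power_mult flip: fps_to_fls_power)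

lemma fls_deriv_fls_exp: "fls_deriv (fls_exp c) = fls_const c * fls_exp c"
  by (simp add: fls_deriv_fps_to_fls fls_times_fps_to_fls)

lemma one_minus_fls_exp_neq_0: "d \<noteq> 0 \<Longrightarrow> 1 - fls_exp (- d) \<noteq> 0"
  by simp

lemma prod_fls_exp: "finite A \<Longrightarrow> (\<Prod>x\<in>A. fls_exp (c x)) = fls_exp (\<Sum>x\<in>A. c x)"
  by (induction A rule: finite_induct) (simp_all add: fls_exp_add)

text \<open>The pole is simple: the numerator starts with 1 and the denominator with
  \<open>d * t\<close>, so the residue is the quotient of the leading coefficients.\<close>

lemma residue_fls_exp_divide:
  assumes "d \<noteq> 0"
  shows "fls_residue (fls_exp c / (1 - fls_exp (- d))) = 1 / d"
proof -
  let ?U = "1 - fls_exp (- d)"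
  have U: "fls_subdegree ?U = 1"
    by (rule fls_subdegree_eqI) (use assms in \<open>auto simp: nat_eq_iff\<close>)
  have E: "fls_subdegree (fls_exp c) = 0"
    by (rule fls_subdegree_eqI) auto
  show ?thesis
    using fls_times_base[of "fls_exp c" "inverse ?U"] U E assms
    by (simp add: fls_divide_def field_simps fls_inverse_subdegree)
qed

text \<open>Tidies the derivative of \<open>inverse (u ^ Suc r)\<close>, with \<open>a * b\<close>
  standing for the derivative of \<open>u\<close>.\<close>

lemma inverse_square_power_Suc:
  fixes u a b :: "'a::field"
  assumes "u \<noteq> 0"
  shows "- (of_nat (Suc r) * u ^ (Suc r - 1) * (a * b)) / (u ^ Suc r)\<^sup>2 =
    - of_nat (Suc r) * a * b * inverse (u ^ Suc (Suc r))"
  using assms by (simp add: field_simps power2_eq_square)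

text \<open>With \<open>U = 1 - e^(-d t)\<close>, the derivative of
  \<open>e^((c + d) t) / U^(r + 1)\<close> has residue 0. The shift by \<open>d\<close> absorbs the
  factor \<open>e^(-d t)\<close> coming from the derivative of \<open>U\<close>.\<close>

lemma residue_fls_exp_divide_power_Suc:
  assumes "d \<noteq> 0"
  shows "real (Suc r) * d * fls_residue (fls_exp c / (1 - fls_exp (- d)) ^ Suc (Suc r)) =
    (c + d) * fls_residue (fls_exp (c + d) / (1 - fls_exp (- d)) ^ Suc r)"
proof -
  let ?U = "1 - fls_exp (- d)"
  have U: "?U \<noteq> 0" using assms by (rule one_minus_fls_exp_neq_0)
  have dU: "fls_deriv ?U = fls_const d * fls_exp (- d)"
    by (simp add: fls_deriv_fls_exp del: fps_to_fls_minus)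
  have "fls_deriv (inverse (?U ^ Suc r)) =
      - of_nat (Suc r) * fls_const d * fls_exp (- d) * inverse (?U ^ Suc (Suc r))"
    unfolding fls_inverse_deriv' fls_deriv_power dU
    using inverse_square_power_Suc[OF U, of r "fls_const d" "fls_exp (- d)"] by simp
  then have deriv: "fls_deriv (fls_exp (c + d) * inverse (?U ^ Suc r)) =
      fls_const (c + d) * (fls_exp (c + d) / ?U ^ Suc r) -
      of_nat (Suc r) * fls_const d * (fls_exp c / ?U ^ Suc (Suc r))"
    unfolding fls_deriv_mult fls_deriv_fls_exp
    by (simp only: fls_exp_add[of "c + d" "- d", simplified] divide_inverse mult_minus_left
        mult_minus_right mult_ac diff_conv_add_uminus add.commute)
  have residue: "fls_residue (fls_const g * A - of_nat m * fls_const d * B) =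
      g * fls_residue A - of_nat m * d * fls_residue B" for g m and A B :: "real fls"
    by (simp add: fls_of_nat fls_const_mult_const mult.assoc)
  show ?thesis
    using fls_residue_deriv[of "fls_exp (c + d) * inverse (?U ^ Suc r)"]
    unfolding deriv residue by linarith
qed

lemma residue_fls_exp_divide_power:
  assumes "d \<noteq> 0"
  shows "fls_residue (fls_exp c / (1 - fls_exp (- d)) ^ Suc r) =
    1 / (d * fact r) * (\<Prod>l = 1..r. c / d + real l)"
\<comment> \<open>\<open>c\<close> must vary, since each step passes from \<open>c\<close> to
  \<open>c + d\<close>.\<close>
proof (induction r arbitrary: c)
  case 0
  then show ?case using residue_fls_exp_divide[OF assms, of c] by simp
next
  case (Suc r)
  define P where "P = (\<Prod>l = 1..r. (c + d) / d + real l)"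
  \<comment> \<open>Once \<open>l = 1\<close> is split off,
    \<open>c / d + (l + 1) = (c + d) / d + l\<close> turns the rest into the product of the
    induction hypothesis at \<open>c + d\<close>.\<close>
  have "(\<Prod>l = 1..Suc r. c / d + real l) =
      (c / d + real 1) * (\<Prod>l = Suc 1..Suc r. c / d + real l)"
    by (rule prod.atLeast_Suc_atMost) simp
  also have "(\<Prod>l = Suc 1..Suc r. c / d + real l) = (\<Prod>l = 1..r. c / d + real (Suc l))"
    by (rule prod.shift_bounds_cl_Suc_ivl)
  also have "\<dots> = P"
    using assms by (simp add: P_def add_divide_distrib algebra_simps)
  finally have prod: "(\<Prod>l = 1..Suc r. c / d + real l) = (c / d + 1) * P" by simp
  have "real (Suc r) * d * fls_residue (fls_exp c / (1 - fls_exp (- d)) ^ Suc (Suc r)) =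
      (c + d) * (1 / (d * fact r) * P)"
    unfolding P_def residue_fls_exp_divide_power_Suc[OF assms] Suc.IH ..
  then have "fls_residue (fls_exp c / (1 - fls_exp (- d)) ^ Suc (Suc r)) =
      (c + d) * (1 / (d * fact r) * P) / (real (Suc r) * d)"
    using assms by (simp only: eq_divide_eq) (simp add: mult.commute)
  also have "\<dots> = 1 / (d * fact (Suc r)) * ((c / d + 1) * P)"
    using assms by (simp add: divide_simps)
  finally show ?case unfolding prod .
qed

section \<open>Squares of geometric sums\<close>

text \<open>The coefficient of \<open>x ^ t\<close> counts the pairs \<open>i, j \<le> m\<close>
  with \<open>i + j = t\<close>. Passing from \<open>m\<close> to \<open>Suc m\<close> keeps the
  coefficients for \<open>t \<le> m\<close> and raises the later ones by 2.\<close>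

lemma geometric_sum_square:
  fixes x :: "'a::comm_ring_1"
  shows "(\<Sum>i\<le>m. x ^ i)\<^sup>2 = (\<Sum>t\<le>2 * m. of_int (1 + min (int t) (2 * int m - int t)) * x ^ t)"
proof (induction m)
  case 0
  then show ?case by simp
next
  case (Suc m)
  let ?c = "\<lambda>m t. of_int (1 + min (int t) (2 * int m - int t)) :: 'a"
  have c: "?c (Suc m) t * x ^ t = ?c m t * x ^ t + (if t \<in> {Suc m..2 * Suc m} then 2 * x ^ t else 0)"
    if "t \<in> {..2 * Suc m}" for t
  proof (cases "t \<le> m")
    case True
    then show ?thesis by simp
  next
    case False
    then have "1 + min (int t) (2 * int (Suc m) - int t) = 1 + min (int t) (2 * int m - int t) + 2"
      by (simp add: min_def)
    then show ?thesis using False that by (simp only: of_int_add) (simp add: algebra_simps)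
  qed
  \<comment> \<open>Beyond \<open>2 * m\<close> the formula gives 0 at \<open>2 * m + 1\<close> but
    -1 at \<open>2 * m + 2\<close>, hence the correction term.\<close>
  have 1: "(\<Sum>t\<le>2 * Suc m. ?c m t * x ^ t) = (\<Sum>i\<le>m. x ^ i)\<^sup>2 - x ^ (2 * Suc m)"
    by (simp add: Suc.IH)
  have 2: "(\<Sum>t\<le>2 * Suc m. if t \<in> {Suc m..2 * Suc m} then 2 * x ^ t else 0) =
      2 * (\<Sum>t=Suc m..2 * Suc m. x ^ t)"
    by (subst sum.inter_restrict[symmetric]) (auto simp: sum_distrib_left intro!: sum.cong)
  have 3: "(\<Sum>t=Suc m..2 * Suc m. x ^ t) = x ^ Suc m * (\<Sum>i\<le>m. x ^ i) + x ^ (2 * Suc m)"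
  proof -
    have "(\<Sum>t=0 + Suc m..Suc m + Suc m. x ^ t) = (\<Sum>t=0..Suc m. x ^ (t + Suc m))"
      by (rule sum.shift_bounds_cl_nat_ivl)
    also have "\<dots> = x ^ Suc m * (\<Sum>i\<le>Suc m. x ^ i)"
      by (simp only: sum_distrib_left power_add atMost_atLeast0 mult.commute)
    also have "\<dots> = x ^ Suc m * (\<Sum>i\<le>m. x ^ i) + x ^ (Suc m + Suc m)"
      by (simp only: sum.atMost_Suc distrib_left power_add)
    finally show ?thesis by (simp only: mult_2 add_0)
  qed
  have sq: "s\<^sup>2 - y * y + 2 * (y * s + y * y) = (s + y)\<^sup>2" for s y :: 'a
    by (simp add: power2_eq_square algebra_simps)
  have "(\<Sum>t\<le>2 * Suc m. ?c (Suc m) t * x ^ t) =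
      (\<Sum>t\<le>2 * Suc m. ?c m t * x ^ t) +
      (\<Sum>t\<le>2 * Suc m. if t \<in> {Suc m..2 * Suc m} then 2 * x ^ t else 0)"
    by (subst sum.distrib[symmetric]) (rule sum.cong[OF refl c])
  also have "\<dots> = (\<Sum>i\<le>Suc m. x ^ i)\<^sup>2"
    unfolding 1 2 3 unfolding sum.atMost_Suc mult_2[of "Suc m"] power_add[of x "Suc m" "Suc m"]
    by (rule sq)
  finally show ?case by simp
qed

lemma sum_int_atLeastAtMost_0: "(\<Sum>t\<in>{0..int m}. f t) = (\<Sum>i\<le>m. f (int i))"
  by (rule sum.reindex_bij_witness[of _ int nat]) auto

section \<open>Multiplicities of the parts\<close>

text \<open>For \<open>j = 5 * q + r - 1\<close>, the residues 2 and 4 modulo 5 mean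
  \<open>r = 3\<close> and \<open>r = 0\<close>. There \<open>phi j\<close> is 2 or 5 modulo 6, that
  is, 2 modulo 3, the residue of the halved parts.\<close>

lemma Bset'_iff:
  "j \<in> Bset' k \<longleftrightarrow> j \<in> Bset k \<and> phi j mod 3 = 2 \<and> phi j \<le> 3 * int (alpha k) - 1"
proof -
  obtain q r where j: "j = 5 * q + r - 1" and r: "0 \<le> r" "r < 5" and phi: "phi j = 6 * q + r - 1"
    by (rule phi_cases)
  have "j = (r - 1) + 5 * q" "phi j = (r - 1) + 3 * (2 * q)" using j phi by simp_all
  then have mods: "j mod 5 = (r - 1) mod 5" "phi j mod 3 = (r - 1) mod 3"
    by (simp_all only: mod_mult_self2)
  have "r \<in> {0, 1, 2, 3, 4}" using r by auto
  then have residues: "(j mod 5 = 2 \<or> j mod 5 = 4) \<longleftrightarrow> r = 0 \<or> r = 3"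
    "phi j mod 3 = 2 \<longleftrightarrow> r = 0 \<or> r = 3"
    unfolding mods by auto
  \<comment> \<open>The parity of \<open>alpha k\<close> decides whether
    \<open>3 * alpha k - 1\<close> is 5 or 2 modulo 6.\<close>
  have "j \<le> phi_inv (3 * int (alpha k) - 1) \<longleftrightarrow> phi j \<le> 3 * int (alpha k) - 1"
    if "r = 0 \<or> r = 3"
  proof (cases "even (alpha k)")
    case True
    then obtain m where m: "alpha k = 2 * m" by (rule evenE)
    then have "phi_inv (3 * int (alpha k) - 1) = 5 * int m - 1" by (simp add: phi_inv_alt)
    then show ?thesis using that j phi m by auto
  next
    case False
    then obtain m where m: "alpha k = 2 * m + 1" by (rule oddE)
    then have "phi_inv (3 * int (alpha k) - 1) = 5 * int m + 2" by (simp add: phi_inv_alt)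
    then show ?thesis using that j phi m by auto
  qed
  then show ?thesis unfolding Bset'_def mem_Collect_eq residues by blast
qed

lemma finite_Bset: "finite (Bset k)"
  by (simp add: Bset_def)

text \<open>The set on the right consists of the values \<open>3 * q + 2\<close> that halving
  \<open>6 * q + 4\<close> puts into \<open>a_seq k\<close> a second time.\<close>

lemma phi_Bset': "bij_betw phi (Bset' k) {i. 1 \<le> i \<and> i mod 3 = 2 \<and> i \<le> 3 * int (alpha k) - 1}"
  (is "bij_betw phi _ ?A")
proof (rule bij_betw_byWitness[where f' = phi_inv])
  have A: "i \<in> Aset k" if "i \<in> ?A" for i
  proof -
    have "i mod 6 mod 3 = 2" using that by (simp add: mod_mod_cancel)
    then have "i mod 6 \<noteq> 4" by auto
    then show ?thesis using that alpha_bounds[of k] by (simp add: Aset_def)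
  qed
  show "\<forall>j\<in>Bset' k. phi_inv (phi j) = j" by (simp add: phi_inv_phi)
  show "\<forall>i\<in>?A. phi (phi_inv i) = i" using A phi_phi_inv by blast
  show "phi ` Bset' k \<subseteq> ?A"
  proof (rule image_subsetI)
    fix j assume j: "j \<in> Bset' k"
    then have "phi j \<in> Aset k" using Bset'_iff phi_in_Aset by blast
    then show "phi j \<in> ?A" using j unfolding Bset'_iff Aset_def by blast
  qed
  show "phi_inv ` ?A \<subseteq> Bset' k"
  proof (rule image_subsetI)
    fix i assume i: "i \<in> ?A"
    show "phi_inv i \<in> Bset' k"
      unfolding Bset'_iff phi_phi_inv[OF A[OF i]]
      using i phi_inv_in_Bset[OF A[OF i]] by blast
  qed
qed

lemma Aset_conv_image: "Aset k = int ` ({1..<3 * k + 2} \<inter> {j. j mod 6 \<noteq> 4})"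
proof (intro equalityI subsetI)
  fix i assume i: "i \<in> Aset k"
  then have "0 \<le> i" by (simp add: Aset_def)
  then obtain j where j: "i = int j" by (rule nonneg_int_cases)
  then have "int (j mod 6) \<noteq> 4" using i by (simp add: Aset_def zmod_int)
  then have "j mod 6 \<noteq> 4" by auto
  then show "i \<in> int ` ({1..<3 * k + 2} \<inter> {j. j mod 6 \<noteq> 4})"
    using i j by (simp add: Aset_def)
next
  fix i assume "i \<in> int ` ({1..<3 * k + 2} \<inter> {j. j mod 6 \<noteq> 4})"
  then obtain j where "i = int j" "1 \<le> j" "j < 3 * k + 2" "j mod 6 \<noteq> 4" by auto
  moreover have "int j mod 6 = int (j mod 6)" by (simp add: zmod_int)
  ultimately show "i \<in> Aset k" by (simp add: Aset_def)
qed

text \<open>\<open>6 * q + 4 \<le> 3 * k + 1\<close> amounts to \<open>2 * q + 1 \<le> k\<close>, so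
  exactly \<open>alpha k\<close> parts are halved.\<close>

lemma mod_6_eq_4_conv_image:
  "{1..<3 * k + 2} \<inter> {j::nat. j mod 6 = 4} = (\<lambda>q. 6 * q + 4) ` {..<alpha k}"
proof (intro equalityI subsetI)
  fix j :: nat assume "j \<in> {1..<3 * k + 2} \<inter> {j::nat. j mod 6 = 4}"
  then have "j = 6 * (j div 6) + 4" "j div 6 < alpha k"
    unfolding alpha_def using mult_div_mod_eq[of 6 j] by auto
  then show "j \<in> (\<lambda>q. 6 * q + 4) ` {..<alpha k}" by blast
next
  fix j assume "j \<in> (\<lambda>q. 6 * q + 4) ` {..<alpha k}"
  then obtain q where "q < alpha k" "j = 6 * q + 4" by auto
  then show "j \<in> {1..<3 * k + 2} \<inter> {j::nat. j mod 6 = 4}" by (simp add: alpha_def mod_simps)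
qed

lemma mod_3_eq_2_conv_image:
  "{i. 1 \<le> i \<and> i mod 3 = 2 \<and> i \<le> 3 * int a - 1} = (\<lambda>q. 3 * int q + 2) ` {..<a}"
proof (intro equalityI subsetI)
  fix i assume "i \<in> {i. 1 \<le> i \<and> i mod 3 = 2 \<and> i \<le> 3 * int a - 1}"
  then have "i = 3 * int (nat (i div 3)) + 2" "nat (i div 3) < a"
    using mult_div_mod_eq[of 3 i] by auto
  then show "i \<in> (\<lambda>q. 3 * int q + 2) ` {..<a}" by blast
qed auto

text \<open>With \<open>f\<close> arbitrary, one identity serves both for the factors of the
  denominator and, for constant \<open>f\<close>, for the total multiplicity.\<close>

lemma prod_list_a_seq:
  fixes f :: "int \<Rightarrow> 'a::comm_monoid_mult"
  shows "(\<Prod>x\<leftarrow>a_seq k. f (int x)) = (\<Prod>j\<in>Bset k. f (phi j) ^ nat (eps k j))"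
proof -
  let ?N = "{1..<3 * k + 2}"
  let ?g = "\<lambda>j. f (int (if j mod 6 = 4 then j div 2 else j))"
  have "(\<Prod>x\<leftarrow>a_seq k. f (int x)) = (\<Prod>j\<in>?N. ?g j)"
    using prod.distinct_set_conv_list[OF distinct_upt, of ?g 1 "3 * k + 2"]
    by (simp add: a_seq_def comp_def del: upt_Suc)
  also have "\<dots> = (\<Prod>j\<in>?N \<inter> {j. j mod 6 \<noteq> 4}. f (int j)) *
      (\<Prod>j\<in>?N \<inter> {j. j mod 6 = 4}. f (int (j div 2)))"
    by (subst prod.Int_Diff[of _ _ "{j. j mod 6 \<noteq> 4}"])
      (auto intro!: arg_cong2[where f = "(*)"] prod.cong)
  also have "(\<Prod>j\<in>?N \<inter> {j. j mod 6 \<noteq> 4}. f (int j)) = (\<Prod>i\<in>Aset k. f i)"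
    unfolding Aset_conv_image by (simp add: prod.reindex)
  also have "\<dots> = (\<Prod>j\<in>Bset k. f (phi j))"
    by (rule prod.reindex_bij_betw[OF phi_bij, symmetric])
  also have "(\<Prod>j\<in>?N \<inter> {j. j mod 6 = 4}. f (int (j div 2))) =
      (\<Prod>i | 1 \<le> i \<and> i mod 3 = 2 \<and> i \<le> 3 * int (alpha k) - 1. f i)"
    \<comment> \<open>Both sets are indexed by the same \<open>q\<close>, as
      \<open>(6 * q + 4) div 2 = 3 * q + 2\<close>.\<close>
    unfolding mod_6_eq_4_conv_image mod_3_eq_2_conv_image
    by (subst (1 2) prod.reindex) (auto simp: inj_on_def intro!: prod.cong arg_cong[where f = f])
  also have "\<dots> = (\<Prod>j\<in>Bset' k. f (phi j))"
    by (rule prod.reindex_bij_betw[OF phi_Bset', symmetric])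
  also have "\<dots> = (\<Prod>j\<in>Bset k \<inter> Bset' k. f (phi j))"
    by (rule prod.cong) (auto simp: Bset'_def)
  also have "\<dots> = (\<Prod>j\<in>Bset k. if j \<in> Bset' k then f (phi j) else 1)"
    by (rule prod.inter_restrict[OF finite_Bset])
  also have "(\<Prod>j\<in>Bset k. f (phi j)) * \<dots> = (\<Prod>j\<in>Bset k. f (phi j) ^ nat (eps k j))"
    unfolding prod.distrib[symmetric]
    by (rule prod.cong) (auto simp: eps_def power2_eq_square)
  finally show ?thesis .
qed

lemma length_a_seq: "length (a_seq k) = 3 * k + 1"
  by (simp add: a_seq_def)

section \<open>Common denominator and termwise residues\<close>

text \<open>A geometric sum with \<open>m + 1 = DD k div phi j\<close> terms telescopes against
  \<open>1 - x\<close>. If \<open>eps k j = 2\<close> it is squared, and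
  \<open>geometric_sum_square\<close> supplies the factors of \<open>s_weight\<close> as
  coefficients.\<close>

lemma eps_factor_expansion:
  fixes k :: nat and j :: int
  assumes j: "j \<in> Bset k"
  defines "m \<equiv> DD k div phi j - 1"
  shows "(1 - fls_exp (- of_int (phi j))) ^ nat (eps k j) *
      (\<Sum>t\<in>{0..eps k j * m}. of_int (if j \<in> Bset' k then 1 + min t (2 * m - t) else 1) *
        fls_exp (- of_int (t * phi j))) =
    (1 - fls_exp (- of_int (DD k))) ^ nat (eps k j)"
proof -
  let ?x = "fls_exp (- of_int (phi j))"
  have phi: "phi j > 0" using phi_in_Aset[OF j] by (simp add: Aset_def)
  then have "DD k div phi j > 0"
    using phi_dvd[OF j] DD_pos[of k] by (simp add: pos_imp_zdiv_pos_iff zdvd_imp_le)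
  then have "0 \<le> m" by (simp add: m_def)
  then obtain M where M: "m = int M" by (rule nonneg_int_cases)
  then have D: "DD k = int (Suc M) * phi j"
    using phi_dvd[OF j] unfolding m_def
    by (metis add.commute diff_add_cancel dvd_div_mult_self of_nat_Suc)
  have pow: "fls_exp (- of_int (int t * phi j)) = ?x ^ t" for t
    by (simp add: fls_exp_power)
  have S: "(1 - ?x) * (\<Sum>i\<le>M. ?x ^ i) = 1 - fls_exp (- of_int (DD k))"
    unfolding D pow by (simp only: sum_gp_basic[symmetric])
  show ?thesis
  proof (cases "j \<in> Bset' k")
    case True
    have "(\<Sum>t\<in>{0..int (2 * M)}. of_int (1 + min t (2 * int M - t)) * fls_exp (- of_int (t * phi j))) =
        (\<Sum>i\<le>M. ?x ^ i)\<^sup>2"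
      unfolding sum_int_atLeastAtMost_0 pow geometric_sum_square ..
    then show ?thesis using True
      by (simp add: eps_def M S[symmetric] power_mult_distrib)
  next
    case False
    have "(\<Sum>t\<in>{0..int M}. fls_exp (- of_int (t * phi j))) = (\<Sum>i\<le>M. ?x ^ i)"
      unfolding sum_int_atLeastAtMost_0 pow ..
    then show ?thesis using False by (simp add: eps_def M S[symmetric])
  qed
qed

text \<open>Multiplying the expansions over all \<open>j\<close> yields one weighted exponential per
  tuple in \<open>Box k\<close>; the residue formula then applies with
  \<open>r = 3 * k\<close>.\<close>

lemma poly_part_a_seq:
  "poly_part (a_seq k) n = 1 / (of_int (DD k) * fact (3 * k)) *
    (\<Sum>t\<in>Box k. of_int (s_weight k t) *
       (\<Prod>l = 1..3 * k. of_int (n - (\<Sum>j\<in>Bset k. t j * phi j)) / of_int (DD k) + real l))"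
proof -
  let ?U = "1 - fls_exp (- of_int (DD k))"
  let ?m = "\<lambda>j. DD k div phi j - 1"
  let ?w = "\<lambda>j t. if j \<in> Bset' k then 1 + min t (2 * ?m j - t) else 1"
  let ?P = "\<Prod>x\<leftarrow>a_seq k. 1 - fls_exp (- real x)"
  let ?c = "\<lambda>t. of_int (n - (\<Sum>j\<in>Bset k. t j * phi j)) :: real"
  let ?N = "\<Sum>t\<in>Box k. of_int (s_weight k t) * fls_exp (- of_int (\<Sum>j\<in>Bset k. t j * phi j))"
  have D: "real_of_int (DD k) \<noteq> 0" using DD_pos[of k] by simp
  then have U: "?U \<noteq> 0" by (rule one_minus_fls_exp_neq_0)
  have w: "(\<Prod>j\<in>Bset k. ?w j (t j)) = s_weight k t" for t
    unfolding s_weight_def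
    by (rule prod.mono_neutral_cong_right) (auto simp: finite_Bset Bset'_def)
  have "?P = (\<Prod>j\<in>Bset k. (1 - fls_exp (- of_int (phi j))) ^ nat (eps k j))"
    using prod_list_a_seq[of "\<lambda>i. 1 - fls_exp (- of_int i)" k] by simp
  moreover have "?N = (\<Prod>j\<in>Bset k. \<Sum>t\<in>{0..eps k j * ?m j}.
      of_int (?w j t) * fls_exp (- of_int (t * phi j)))"
    unfolding Box_def w[symmetric]
    by (subst prod_sum_PiE)
      (simp_all add: finite_Bset prod.distrib prod_fls_exp sum_negf del: of_int_mult)
  ultimately have "?P * ?N = (\<Prod>j\<in>Bset k. ?U ^ nat (eps k j))"
    by (simp only: prod.distrib[symmetric]) (rule prod.cong[OF refl eps_factor_expansion])
  \<comment> \<open>The constant \<open>f\<close> shows that the multiplicities add up to the length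
    of \<open>a_seq k\<close>.\<close>
  also have "\<dots> = ?U ^ (3 * k + 1)"
    using prod_list_a_seq[of "\<lambda>_. ?U" k] length_a_seq[of k]
    by (simp add: map_replicate_const)
  finally have PN: "?P * ?N = ?U ^ Suc (3 * k)" by simp
  have exp: "fls_exp (of_int n) * fls_exp (- of_int i) = fls_exp (of_int (n - i))" for i
    by (simp flip: fls_exp_add)
  have quotient: "e / p = e * q / u" if "p * q = u" "u \<noteq> 0" for e p q u :: "real fls"
    using that by (metis mult_divide_mult_cancel_right mult_eq_0_iff)
  have "fls_exp (of_int n) / ?P = fls_exp (of_int n) * ?N / ?U ^ Suc (3 * k)"
    by (rule quotient[OF PN power_not_zero[OF U]])
  also have "\<dots> = (\<Sum>t\<in>Box k. of_int (s_weight k t) * (fls_exp (?c t) / ?U ^ Suc (3 * k)))"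
    unfolding sum_distrib_left sum_divide_distrib
    by (simp only: exp mult.left_commute[of "fls_exp (of_int n)"] times_divide_eq_right)
  finally have "poly_part (a_seq k) n =
      (\<Sum>t\<in>Box k. of_int (s_weight k t) * fls_residue (fls_exp (?c t) / ?U ^ Suc (3 * k)))"
    unfolding poly_part_def
    by (simp only: fls_nth_sum fls_residue_def fls_residue_of_int_times[unfolded fls_residue_def])
  then show ?thesis
    unfolding residue_fls_exp_divide_power[OF D] sum_distrib_left
    by (simp only: mult.left_commute)
qed

theorem theorem5p2:
  fixes k :: nat and n :: int
  assumes "k \<ge> 1" and "n \<ge> 0"
  shows "PP k n =
    1 / (of_int (DD k) * fact (3 * k)) *
    (\<Sum>J\<in>Pow {alpha k + 1..k}. \<Sum>t\<in>Box k.
       of_int (s_weight k t) *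
       (\<Prod>l = 1..3 * k.
          of_int (n - (\<Sum>j\<in>Bset k. t j * phi j) - mJ J) / of_int (DD k) + real l))"
proof -
  \<comment> \<open>Moves the shift by \<open>mJ J\<close>, which enters through the argument of
    \<open>poly_part\<close>, to the end, as in the claim.\<close>
  have comm: "n - mJ J - i = n - i - mJ J" for J i by simp
  show ?thesis unfolding PP_def poly_part_a_seq comm sum_distrib_left ..
qed

end
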